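(* Consider the weakly convex game with $0<\eta<\min_i\rho_i^{-1}$ and $\mu>0$, and assume (C1): for every $i$, every $x_i\in X_i$ and all $y,w\in X$, $\|\nabla_{x_i}\hat f_i^\eta(x_i,y)-\nabla_{x_i}\hat f_i^\eta(x_i,w)\|\le\hat L_i\|y_i-w_i\|+\hat L_{-i}\|y_{-i}-w_{-i}\|$; and (C2): the spectral norm of $\Gamma_2$ is $<1$. Then: (i) for all $y,w\in X$, $(\|\hat x^\eta_i(y)-\hat x^\eta_i(w)\|)_{i=1}^N\le\Gamma_2(\|y_i-w_i\|)_{i=1}^N$ componentwise, so $\hat x^\eta:X\to X$ is a contraction (w.r.t. $\|x\|_*=\|(\|x_1\|,\dots,\|x_N\|)\|_2$) with a unique fixed point $x^*$; (ii) $x^*$ is the unique QNE of the Moreau-smoothed game over $X$, i.e. the unique $x\in X$ with $\nabla_{x_i}f_i^\eta(x)^\top(z_i-x_i)\ge0$ for all $z_i\in X_i$ and all $i$; if in addition each $X_i$ is compact and each $\partial_{x_i}f_i(\cdot,x_{-i})$ is $L_i$-Lipschitz, then $x^*$ is an $\eta LDM^*$-QNE of the original game, with $L=\max_iL_i$, $D=\max_i\operatorname{diam}(X_i)$, $M^*=\max_i\|\nabla_{x_i}f_i^\eta(x^* )\|$; (iii) if $\varepsilon_i^k\ge0$ with $\sum_k\varepsilon_i^k<\infty$ for all $i$, the MS-SSBR iterates satisfy $x^k\to x^*$ almost surely.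
   Context: $N$-player game: player $i$ has nonempty closed convex $X_i\subseteq\mathbb{R}^{n_i}$ and real-valued $f_i$ with $f_i(\cdot,x_{-i})$ $\rho_i$-weakly convex ($f_i+\frac{\rho_i}2\|\cdot\|^2$ convex) for each $x_{-i}$; $X=\prod_iX_i$. Moreau envelope $f_i^\eta(x_i,x_{-i})=\min_y\{f_i(y,x_{-i})+\frac1{2\eta}\|y-x_i\|^2\}$. Quadratic surrogate near $y\in X$: $\hat f_i^\eta(z,y)\triangleq f_i^\eta(y)+\nabla_{x_i}f_i^\eta(y)^\top(z-y_i)+\frac\mu2\|z-y_i\|^2$. Best response $\hat x_i^\eta(x)\triangleq\operatorname*{argmin}_{z\in X_i}\hat f_i^\eta(z,x)$. $\Gamma_2\in\mathbb{R}^{N\times N}$: $(\Gamma_2)_{ii}=\hat L_i/\mu$, $(\Gamma_2)_{ij}=\hat L_{-i}/\mu$ for $j\ne i$. QNE / $\epsilon$-QNE of the original game: $x\in X$ with $f_i'(x_i,x_{-i};z_i-x_i)\ge-\epsilon$ for all $z_i\in X_i$, all $i$ ($\epsilon=0$ for QNE), $f_i'$ the directional derivative in $x_i$. Subdifferential of a $\rho$-weakly convex $g$: $\partial(g+\frac\rho2\|\cdot\|^2)-\rho x$; a set-valued $F$ is $L$-Lipschitz if $F(u)\subseteq F(v)+L\|u-v\|\mathbb{B}$. MS-SSBR: $x^0\in X$; at iteration $k$ each player $i$ produces random $x_i^{k+1}\in X_i$ with $\mathbb{E}[\|x_i^{k+1}-\hat x_i^\eta(x^k)\|^2\mid x^k]\le(\varepsilon_i^k)^2$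 a.s. *)

theory Defs
  imports "HOL-Analysis.Analysis" "HOL-Probability.Probability"
begin

(* Players are indexed by a finite type 'p (N = CARD('p)).  All players' strategy
   spaces live in one Euclidean space 'v; player i's own space R^{n_i} is modelled
   by a linear subspace S i of 'v (isometric to R^{dim (S i)}).  A strategy profile
   is a map x :: 'p \<Rightarrow> 'v with x i \<in> S i. *)

definition profiles :: "('p \<Rightarrow> 'v set) \<Rightarrow> ('p \<Rightarrow> 'v) set" where
  "profiles X = {x. \<forall>i. x i \<in> X i}"

definition weakly_convex_on :: "real \<Rightarrow> 'v::real_normed_vector set \<Rightarrow> ('v \<Rightarrow> real) \<Rightarrow> bool" where
  "weakly_convex_on \<rho> S g \<longleftrightarrow> convex_on S (\<lambda>u. g u + \<rho> / 2 * (norm u)\<^sup>2)"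

definition moreau_env :: "real \<Rightarrow> 'v::real_normed_vector set \<Rightarrow> ('v \<Rightarrow> real) \<Rightarrow> 'v \<Rightarrow> real" where
  "moreau_env \<eta> S g u = Inf ((\<lambda>y. g y + 1 / (2 * \<eta>) * (norm (y - u))\<^sup>2) ` S)"

definition grad_on :: "'v::euclidean_space set \<Rightarrow> ('v \<Rightarrow> real) \<Rightarrow> 'v \<Rightarrow> 'v" where
  "grad_on S g u = (THE v. v \<in> S \<and> (g has_derivative (\<lambda>h. v \<bullet> h)) (at u within S))"

definition pgrad :: "('p \<Rightarrow> 'v::euclidean_space set) \<Rightarrow> (('p \<Rightarrow> 'v) \<Rightarrow> real) \<Rightarrow> 'p \<Rightarrow> ('p \<Rightarrow> 'v) \<Rightarrow> 'v" where
  "pgrad S g i x = grad_on (S i) (\<lambda>z. g (x(i := z))) (x i)"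

definition fenv :: "('p \<Rightarrow> 'v::euclidean_space set) \<Rightarrow> ('p \<Rightarrow> ('p \<Rightarrow> 'v) \<Rightarrow> real) \<Rightarrow> real \<Rightarrow> 'p \<Rightarrow> ('p \<Rightarrow> 'v) \<Rightarrow> real" where
  "fenv S f \<eta> i x = moreau_env \<eta> (S i) (\<lambda>y. f i (x(i := y))) (x i)"

definition fhat :: "('p \<Rightarrow> 'v::euclidean_space set) \<Rightarrow> ('p \<Rightarrow> ('p \<Rightarrow> 'v) \<Rightarrow> real) \<Rightarrow> real \<Rightarrow> real \<Rightarrow> 'p \<Rightarrow> 'v \<Rightarrow> ('p \<Rightarrow> 'v) \<Rightarrow> real" where
  "fhat S f \<eta> \<mu> i z y = fenv S f \<eta> i y + pgrad S (fenv S f \<eta> i) i y \<bullet> (z - y i) + \<mu> / 2 * (norm (z - y i))\<^sup>2"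

definition bresp :: "('p \<Rightarrow> 'v::euclidean_space set) \<Rightarrow> ('p \<Rightarrow> 'v set) \<Rightarrow> ('p \<Rightarrow> ('p \<Rightarrow> 'v) \<Rightarrow> real) \<Rightarrow> real \<Rightarrow> real \<Rightarrow> 'p \<Rightarrow> ('p \<Rightarrow> 'v) \<Rightarrow> 'v" where
  "bresp S X f \<eta> \<mu> i x = (THE z. z \<in> X i \<and> (\<forall>w \<in> X i. fhat S f \<eta> \<mu> i z x \<le> fhat S f \<eta> \<mu> i w x))"

definition Gamma2 :: "('p::finite \<Rightarrow> real) \<Rightarrow> ('p \<Rightarrow> real) \<Rightarrow> real \<Rightarrow> real^'p^'p" where
  "Gamma2 Lh Lm \<mu> = (\<chi> i j. if i = j then Lh i / \<mu> else Lm i / \<mu>)"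

definition spectral_norm :: "real^'n^'m \<Rightarrow> real" where
  "spectral_norm A = onorm (\<lambda>v. A *v v)"

definition norm_star :: "('p::finite \<Rightarrow> 'v::real_normed_vector) \<Rightarrow> real" where
  "norm_star x = sqrt (\<Sum>j\<in>UNIV. (norm (x j))\<^sup>2)"

definition norm_minus :: "'p::finite \<Rightarrow> ('p \<Rightarrow> 'v::real_normed_vector) \<Rightarrow> real" where
  "norm_minus i x = sqrt (\<Sum>j\<in>UNIV - {i}. (norm (x j))\<^sup>2)"

definition smoothed_QNE :: "('p \<Rightarrow> 'v::euclidean_space set) \<Rightarrow> ('p \<Rightarrow> 'v set) \<Rightarrow> ('p \<Rightarrow> ('p \<Rightarrow> 'v) \<Rightarrow> real) \<Rightarrow> real \<Rightarrow> ('p \<Rightarrow> 'v) \<Rightarrow> bool" where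
  "smoothed_QNE S X f \<eta> x \<longleftrightarrow> x \<in> profiles X \<and>
     (\<forall>i. \<forall>z \<in> X i. pgrad S (fenv S f \<eta> i) i x \<bullet> (z - x i) \<ge> 0)"

definition eps_QNE :: "('p \<Rightarrow> 'v set) \<Rightarrow> ('p \<Rightarrow> ('p \<Rightarrow> 'v::real_normed_vector) \<Rightarrow> real) \<Rightarrow> real \<Rightarrow> ('p \<Rightarrow> 'v) \<Rightarrow> bool" where
  "eps_QNE X f \<epsilon> x \<longleftrightarrow> x \<in> profiles X \<and>
     (\<forall>i. \<forall>z \<in> X i. \<exists>l. ((\<lambda>t. (f i (x(i := x i + t *\<^sub>R (z - x i))) - f i x) / t) \<longlongrightarrow> l) (at_right 0)
                         \<and> l \<ge> - \<epsilon>)"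

definition convex_subdiff :: "'v::euclidean_space set \<Rightarrow> ('v \<Rightarrow> real) \<Rightarrow> 'v \<Rightarrow> 'v set" where
  "convex_subdiff S h u = {v \<in> S. \<forall>y \<in> S. h y \<ge> h u + v \<bullet> (y - u)}"

definition wc_subdiff :: "real \<Rightarrow> 'v::euclidean_space set \<Rightarrow> ('v \<Rightarrow> real) \<Rightarrow> 'v \<Rightarrow> 'v set" where
  "wc_subdiff \<rho> S g u = (\<lambda>v. v - \<rho> *\<^sub>R u) ` convex_subdiff S (\<lambda>y. g y + \<rho> / 2 * (norm y)\<^sup>2) u"

definition setval_lipschitz_on :: "'v::real_normed_vector set \<Rightarrow> real \<Rightarrow> ('v \<Rightarrow> 'w::real_normed_vector set) \<Rightarrow> bool" where
  "setval_lipschitz_on S L F \<longleftrightarrow>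
     (\<forall>u \<in> S. \<forall>v \<in> S. \<forall>a \<in> F u. \<exists>b \<in> F v. norm (a - b) \<le> L * norm (u - v))"

definition ms_ssbr :: "'w measure \<Rightarrow> ('p \<Rightarrow> 'v::euclidean_space set) \<Rightarrow> ('p \<Rightarrow> 'v set) \<Rightarrow> ('p \<Rightarrow> ('p \<Rightarrow> 'v) \<Rightarrow> real) \<Rightarrow> real \<Rightarrow> real \<Rightarrow> ('p \<Rightarrow> nat \<Rightarrow> real) \<Rightarrow> (nat \<Rightarrow> 'w \<Rightarrow> ('p \<Rightarrow> 'v)) \<Rightarrow> bool" where
  "ms_ssbr M S X f \<eta> \<mu> \<epsilon> xk \<longleftrightarrow>
     (\<forall>k. xk k \<in> measurable M borel) \<and>
     (\<forall>k. \<forall>\<omega> \<in> space M. xk k \<omega> \<in> profiles X) \<and>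
     (\<forall>k i. AE \<omega> in M.
        nn_cond_exp M (vimage_algebra (space M) (xk k) borel)
          (\<lambda>\<omega>. ennreal ((norm (xk (Suc k) \<omega> i - bresp S X f \<eta> \<mu> i (xk k \<omega>)))\<^sup>2)) \<omega>
        \<le> ennreal ((\<epsilon> i k)\<^sup>2))"

end

theory Submission
  imports Defs
begin

text \<open>
  Strong convexity of the proximal subproblem makes the prox map \<open>P\<close> single-valued and
  Lipschitz, so the Moreau envelope is differentiable with gradient \<open>(u - P u) / \<eta>\<close>, which is a
  subgradient of the original function at \<open>P u\<close>. The best response is then the projection of
  \<open>y\<^sub>i - \<nabla>\<^sub>i f\<^sub>i\<^sup>\<eta>(y) / \<mu>\<close> onto \<open>X\<^sub>i\<close>. Projections are nonexpansive, which with the Lipschitz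
  hypothesis gives the componentwise bound by \<open>\<Gamma>\<^sub>2\<close> and hence the contraction, and
  the variational inequality of the projection says that the fixed points are the smoothed equilibria.
  The subgradient at \<open>P u\<close> can be moved to \<open>u\<close> at cost \<open>L \<eta> \<parallel>\<nabla>f\<^sup>\<eta>(u)\<parallel>\<close>, which bounds the
  directional derivatives of the original game. For the random iterates, the squared errors have
  summable expectations, so the errors tend to \<open>0\<close> almost surely, and a contraction with
  vanishing perturbations converges.
\<close>

section \<open>Moreau envelopes of weakly convex functions\<close>

text \<open>A proper subspace has empty interior, so continuity of convex functions on open sets
  does not apply to \<open>h\<close> itself. Composing with a linear retraction \<open>P\<close>
  onto \<open>S\<close> gives a convex function on the whole space that agrees with \<open>h\<close>
  on \<open>S\<close>.\<close>

lemma convex_on_subspace_imp_continuous_on: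
  fixes h :: "'v::euclidean_space \<Rightarrow> real"
  assumes "subspace S" "convex_on S h"
  shows "continuous_on S h"
proof -
  obtain P where P: "range P \<subseteq> S" "linear P" "\<And>v. v \<in> S \<Longrightarrow> P v = v"
    using linear_exists_left_inverse_on[OF linear_id assms(1) inj_on_id] by auto
  have "convex_on UNIV (\<lambda>x. h (P x))"
  proof (rule convex_onI)
    fix t :: real and x y
    assume "0 < t" "t < 1"
    then show "h (P ((1 - t) *\<^sub>R x + t *\<^sub>R y)) \<le> (1 - t) * h (P x) + t * h (P y)"
      using convex_onD[OF assms(2), of t "P x" "P y"] P(1)
      by (simp add: linear_add[OF P(2)] linear_cmul[OF P(2)] image_subset_iff)
  qed auto
  then have "continuous_on S (\<lambda>x. h (P x))"
    using convex_on_continuous[OF open_UNIV] continuous_on_subset by blast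
  then show ?thesis
    by (rule continuous_on_eq) (simp add: P(3))
qed

text \<open>No lower bound on \<open>k\<close> is assumed. Convexity lets \<open>k\<close> decrease
  at most linearly along rays from \<open>u\<close>, so the quadratic wins far away and the minimum
  over a compact ball is global.\<close>

lemma convex_plus_quadratic_attains_min:
  fixes k :: "'v::euclidean_space \<Rightarrow> real"
  assumes S: "subspace S" and k: "convex_on S k" and c: "c > 0" and u: "u \<in> S"
  shows "\<exists>p\<in>S. \<forall>y\<in>S. k p + c / 2 * (norm (p - u))\<^sup>2 \<le> k y + c / 2 * (norm (y - u))\<^sup>2"
proof -
  have cont: "continuous_on S k"
    by (rule convex_on_subspace_imp_continuous_on[OF S k])
  have "compact (sphere u 1 \<inter> S)"
    by (intro compact_Int_closed closed_subspace S) simp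
  then have "bounded (k ` (sphere u 1 \<inter> S))"
    by (intro compact_imp_bounded compact_continuous_image continuous_on_subset[OF cont]) auto
  then obtain B where B: "\<And>y. y \<in> sphere u 1 \<inter> S \<Longrightarrow> \<bar>k y\<bar> \<le> B"
    unfolding bounded_iff by (metis imageI real_norm_def)
  define m where "m = - B"
  have m: "m \<le> k y" if "y \<in> S" "norm (y - u) = 1" for y
    using B[of y] that by (auto simp: m_def dist_norm norm_minus_commute)
  have lower: "k u + norm (y - u) * (m - k u) \<le> k y" if y: "y \<in> S" "1 \<le> norm (y - u)" for y
  proof -
    define r where "r = norm (y - u)"
    have r: "1 \<le> r" using y by (simp add: r_def)
    \<comment> \<open>The point where the segment from \<open>u\<close> to \<open>y\<close> crosses
      the unit sphere around \<open>u\<close>; there \<open>m\<close> bounds \<open>k\<close> from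
      below.\<close>
    define z where "z = (1 - 1 / r) *\<^sub>R u + (1 / r) *\<^sub>R y"
    have "z \<in> S"
      unfolding z_def using S u y by (intro subspace_add subspace_scale)
    moreover have "z - u = (1 / r) *\<^sub>R (y - u)"
      by (simp add: z_def algebra_simps)
    then have "norm (z - u) = 1"
      using r by (auto simp: r_def)
    ultimately have "m \<le> k z" by (rule m)
    also have "\<dots> \<le> (1 - 1 / r) * k u + (1 / r) * k y"
      unfolding z_def using r by (intro convex_onD[OF k] u y) auto
    finally have "r * m \<le> r * ((1 - 1 / r) * k u + (1 / r) * k y)"
      using r by (intro mult_left_mono) auto
    also have "\<dots> = (r - 1) * k u + k y"
      using r by (simp add: field_simps)
    finally show ?thesis
      unfolding r_def[symmetric] by (simp add: algebra_simps)
  qed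
  \<comment> \<open>Beyond distance \<open>2 * (k u - m) / c\<close> the quadratic term outweighs
    the linear decrease from \<open>lower\<close>, so \<open>?F\<close> is at least its value at
    \<open>u\<close>. The \<open>1\<close> keeps \<open>lower\<close> applicable.\<close>
  define R where "R = max 1 (2 * (k u - m) / c)"
  let ?F = "\<lambda>y. k y + c / 2 * (norm (y - u))\<^sup>2"
  have "compact (cball u R \<inter> S)"
    by (intro compact_Int_closed closed_subspace S) simp
  moreover have "u \<in> cball u R \<inter> S"
    using u by (simp add: R_def)
  moreover have "continuous_on (cball u R \<inter> S) ?F"
    by (intro continuous_intros continuous_on_subset[OF cont]) auto
  ultimately obtain p where p: "p \<in> cball u R \<inter> S" "\<And>y. y \<in> cball u R \<inter> S \<Longrightarrow> ?F p \<le> ?F y"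
    using continuous_attains_inf[of "cball u R \<inter> S" ?F] by blast
  have "?F p \<le> ?F y" if y: "y \<in> S" for y
  proof (cases "norm (y - u) \<le> R")
    case True
    then show ?thesis using p(2)[of y] y by (simp add: dist_norm norm_minus_commute)
  next
    case False
    define r where "r = norm (y - u)"
    have r: "1 \<le> r" "2 * (k u - m) / c \<le> r"
      using False by (auto simp: R_def r_def)
    have "k u - m \<le> c / 2 * r"
      using r(2) c by (simp add: field_simps)
    then have "r * (k u - m) \<le> r * (c / 2 * r)"
      using r by (intro mult_left_mono) auto
    moreover have "?F p \<le> k u"
      using p(2)[of u] \<open>u \<in> cball u R \<inter> S\<close> by simp
    moreover have "k u + r * (m - k u) \<le> k y"
      using lower[OF y] r by (simp add: r_def)
    ultimately show ?thesis
      unfolding r_def[symmetric] by (simp add: algebra_simps power2_eq_square)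
  qed
  then show ?thesis using p(1) by blast
qed

text \<open>Along the segment from \<open>p\<close> to \<open>y\<close> the curvature of the
  quadratic leaves a surplus over minimality of \<open>p\<close>. Dividing by the parameter
  \<open>t\<close> and sending it to \<open>0\<close> gives the full constant; with
  \<open>s = 1 - t\<close> this limit is \<open>field_le_mult_one_interval\<close>.\<close>

lemma convex_plus_quadratic_growth:
  fixes k :: "'v::real_inner \<Rightarrow> real"
  assumes k: "convex_on S k" and p: "p \<in> S" and y: "y \<in> S"
    and min: "\<And>y. y \<in> S \<Longrightarrow> k p + c / 2 * (norm (p - u))\<^sup>2 \<le> k y + c / 2 * (norm (y - u))\<^sup>2"
  shows "k p + c / 2 * (norm (p - u))\<^sup>2 + c / 2 * (norm (y - p))\<^sup>2 \<le> k y + c / 2 * (norm (y - u))\<^sup>2"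
proof -
  let ?F = "\<lambda>y. k y + c / 2 * (norm (y - u))\<^sup>2"
  have "c / 2 * (norm (y - p))\<^sup>2 \<le> ?F y - ?F p"
  proof (rule field_le_mult_one_interval)
    fix s :: real assume s: "0 < s" "s < 1"
    define t where "t = 1 - s"
    have t: "0 < t" "t < 1" using s by (auto simp: t_def)
    define z where "z = (1 - t) *\<^sub>R p + t *\<^sub>R y"
    have "z \<in> S"
      unfolding z_def using convex_on_imp_convex[OF k] t p y by (intro convexD) auto
    have sq: "(norm (z - u))\<^sup>2
        = (1 - t) * (norm (p - u))\<^sup>2 + t * (norm (y - u))\<^sup>2 - t * (1 - t) * (norm (y - p))\<^sup>2"
      unfolding z_def power2_norm_eq_inner
      by (simp add: inner_simps algebra_simps inner_commute)
    have "?F p \<le> ?F z" by (rule min) fact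
    also have "\<dots> \<le> (1 - t) * k p + t * k y + c / 2 * (norm (z - u))\<^sup>2"
      using convex_onD[OF k, of t p y] t p y by (simp add: z_def)
    also have "\<dots> = ?F p + t * (?F y - ?F p - s * (c / 2 * (norm (y - p))\<^sup>2))"
      unfolding sq by (simp add: t_def field_simps)
    finally have "0 \<le> t * (?F y - ?F p - s * (c / 2 * (norm (y - p))\<^sup>2))" by simp
    then show "s * (c / 2 * (norm (y - p))\<^sup>2) \<le> ?F y - ?F p"
      using t by (simp add: zero_le_mult_iff)
  qed
  then show ?thesis by simp
qed

lemma weakly_convex_prox_exists:
  fixes g :: "'v::euclidean_space \<Rightarrow> real"
  assumes S: "subspace S" and g: "weakly_convex_on \<rho> S g" and \<eta>: "\<eta> > 0" "\<eta> * \<rho> < 1" and u: "u \<in> S"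
  shows "\<exists>p\<in>S. \<forall>y\<in>S. g p + 1 / (2 * \<eta>) * (norm (p - u))\<^sup>2 + (1 / \<eta> - \<rho>) / 2 * (norm (y - p))\<^sup>2
      \<le> g y + 1 / (2 * \<eta>) * (norm (y - u))\<^sup>2"
proof -
  define c where "c = 1 / \<eta> - \<rho>"
  have c: "c > 0" using \<eta> by (simp add: c_def field_simps)
  \<comment> \<open>This is \<open>g y + \<rho> / 2 * (norm (y - u))\<^sup>2\<close> with the square
    expanded, that is, the convexified function plus an affine one. The curvature left over from the
    proximal term is \<open>c\<close>.\<close>
  define k where "k y = (g y + \<rho> / 2 * (norm y)\<^sup>2) + (\<rho> / 2 * (norm u)\<^sup>2 - \<rho> * (u \<bullet> y))" for y
  have "convex_on S (\<lambda>y. \<rho> / 2 * (norm u)\<^sup>2 - \<rho> * (u \<bullet> y))"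
    by (rule convex_onI) (auto simp: subspace_imp_convex[OF S] inner_simps field_simps)
  then have k: "convex_on S k"
    unfolding k_def by (rule convex_on_add[OF g[unfolded weakly_convex_on_def]])
  have F: "k y + c / 2 * (norm (y - u))\<^sup>2 = g y + 1 / (2 * \<eta>) * (norm (y - u))\<^sup>2" for y
    unfolding k_def c_def power2_norm_eq_inner
    by (simp add: inner_simps algebra_simps inner_commute diff_divide_distrib add_divide_distrib)
  obtain p where p: "p \<in> S"
    "\<And>y. y \<in> S \<Longrightarrow> k p + c / 2 * (norm (p - u))\<^sup>2 \<le> k y + c / 2 * (norm (y - u))\<^sup>2"
    using convex_plus_quadratic_attains_min[OF S k c u] by blast
  show ?thesis
    using convex_plus_quadratic_growth[OF k p(1) _ p(2)] p(1)
    unfolding F c_def[symmetric] by blast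
qed

text \<open>The proximal point at one argument is a competitor at the other. This bounds the
  first-order error from both sides by multiples of the squared distance, where the lower side uses
  that the prox map \<open>P\<close> is Lipschitz at \<open>u\<close>.\<close>

lemma moreau_env_has_derivative:
  fixes g :: "'v::euclidean_space \<Rightarrow> real"
  assumes S: "subspace S" and g: "weakly_convex_on \<rho> S g" and \<eta>: "\<eta> > 0" "\<eta> * \<rho> < 1" and u: "u \<in> S"
  shows "\<exists>p\<in>S. (moreau_env \<eta> S g has_derivative (\<lambda>h. ((1 / \<eta>) *\<^sub>R (u - p)) \<bullet> h)) (at u within S)
      \<and> (1 / \<eta>) *\<^sub>R (u - p) \<in> wc_subdiff \<rho> S g p"
proof -
  define c where "c = 1 / \<eta> - \<rho>"
  have c: "c > 0" using \<eta> by (simp add: c_def field_simps)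
  let ?F = "\<lambda>x y. g y + 1 / (2 * \<eta>) * (norm (y - x))\<^sup>2"
  obtain P where P: "\<And>x. x \<in> S \<Longrightarrow> P x \<in> S"
    and grow: "\<And>x y. x \<in> S \<Longrightarrow> y \<in> S \<Longrightarrow> ?F x (P x) + c / 2 * (norm (y - P x))\<^sup>2 \<le> ?F x y"
    using weakly_convex_prox_exists[OF S g \<eta>] unfolding c_def[symmetric] by metis
  have le: "?F x (P x) \<le> ?F x y" if "x \<in> S" "y \<in> S" for x y
    using grow[OF that] c by (smt (verit, best) mult_nonneg_nonneg zero_le_power2 divide_nonneg_pos)
  have env: "moreau_env \<eta> S g x = ?F x (P x)" if "x \<in> S" for x
    unfolding moreau_env_def using le[OF that] P[OF that] by (intro cInf_eq_minimum) auto
  \<comment> \<open>Adding the growth inequalities at \<open>u\<close> tested with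
    \<open>P x\<close> and at \<open>x\<close> tested with \<open>P u\<close> cancels all values of
    \<open>g\<close> and leaves an inner product for Cauchy-Schwarz.\<close>
  have lip: "c * norm (P x - P u) \<le> norm (x - u) / \<eta>" if x: "x \<in> S" for x
  proof -
    have "?F u (P x) - ?F x (P x) + ?F x (P u) - ?F u (P u) = 1 / \<eta> * ((P x - P u) \<bullet> (x - u))"
      unfolding power2_norm_eq_inner
      by (simp add: inner_simps algebra_simps inner_commute diff_divide_distrib add_divide_distrib)
    moreover have "(P x - P u) \<bullet> (x - u) \<le> norm (P x - P u) * norm (x - u)"
      by (rule norm_cauchy_schwarz)
    then have "1 / \<eta> * ((P x - P u) \<bullet> (x - u)) \<le> 1 / \<eta> * (norm (P x - P u) * norm (x - u))"
      using \<eta> by (intro mult_left_mono) auto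
    moreover have "c * (norm (P x - P u))\<^sup>2 \<le> ?F u (P x) - ?F x (P x) + ?F x (P u) - ?F u (P u)"
      using grow[OF u P[OF x]] grow[OF x P[OF u]] by (simp add: norm_minus_commute)
    ultimately have "norm (P x - P u) * (c * norm (P x - P u)) \<le> norm (P x - P u) * (norm (x - u) / \<eta>)"
      by (simp add: power2_eq_square algebra_simps)
    then show ?thesis
      using \<eta> by (cases "P x = P u") (simp_all add: mult_le_cancel_left_pos del: times_divide_eq_right)
  qed
  define v where "v = (1 / \<eta>) *\<^sub>R (u - P u)"
  \<comment> \<open>The first summand is the error of the upper estimate, the second that of the
    lower one, to which \<open>lip\<close> contributes a factor
    \<open>1 / (c * \<eta>)\<close>.\<close>
  define K where "K = 1 / (2 * \<eta>) + 1 / (c * \<eta> * \<eta>)"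
  have K: "K > 0" using c \<eta> by (simp add: K_def add_pos_pos)
  have bound: "\<bar>moreau_env \<eta> S g x - moreau_env \<eta> S g u - v \<bullet> (x - u)\<bar> \<le> K * (norm (x - u))\<^sup>2"
    if x: "x \<in> S" for x
  proof -
    define d where "d = norm (x - u)"
    have "?F x (P u) = ?F u (P u) + v \<bullet> (x - u) + 1 / (2 * \<eta>) * d\<^sup>2"
      unfolding power2_norm_eq_inner v_def d_def
      by (simp add: inner_simps algebra_simps inner_commute diff_divide_distrib add_divide_distrib)
    then have upper: "moreau_env \<eta> S g x - moreau_env \<eta> S g u - v \<bullet> (x - u) \<le> 1 / (2 * \<eta>) * d\<^sup>2"
      using le[OF x P[OF u]] by (simp add: env x u)
    have "?F u (P x) = ?F x (P x) - v \<bullet> (x - u) + 1 / \<eta> * ((P x - P u) \<bullet> (x - u)) - 1 / (2 * \<eta>) * d\<^sup>2"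
      unfolding power2_norm_eq_inner v_def d_def
      by (simp add: inner_simps algebra_simps inner_commute diff_divide_distrib add_divide_distrib)
    then have lower: "- (1 / \<eta> * ((P x - P u) \<bullet> (x - u)))
        \<le> moreau_env \<eta> S g x - moreau_env \<eta> S g u - v \<bullet> (x - u)"
      using le[OF u P[OF x]] \<eta> by (simp add: env x u) (smt (verit, best) divide_nonneg_pos zero_le_power2)
    have "norm (P x - P u) \<le> 1 / (c * \<eta>) * d"
      using lip[OF x] c \<eta> by (simp add: d_def field_simps)
    then have "norm (P x - P u) * norm (x - u) \<le> 1 / (c * \<eta>) * d * d"
      unfolding d_def by (rule mult_right_mono) simp
    then have "(P x - P u) \<bullet> (x - u) \<le> 1 / (c * \<eta>) * d * d"
      using norm_cauchy_schwarz order_trans by blast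
    then have "1 / \<eta> * ((P x - P u) \<bullet> (x - u)) \<le> 1 / \<eta> * (1 / (c * \<eta>) * d * d)"
      using \<eta> by (intro mult_left_mono) auto
    also have "\<dots> = 1 / (c * \<eta> * \<eta>) * d\<^sup>2"
      by (simp add: power2_eq_square)
    finally have 1: "1 / \<eta> * ((P x - P u) \<bullet> (x - u)) \<le> 1 / (c * \<eta> * \<eta>) * d\<^sup>2" .
    have 2: "0 \<le> 1 / (2 * \<eta>) * d\<^sup>2" "0 \<le> 1 / (c * \<eta> * \<eta>) * d\<^sup>2"
      using c \<eta> by auto
    have 3: "K * d\<^sup>2 = 1 / (2 * \<eta>) * d\<^sup>2 + 1 / (c * \<eta> * \<eta>) * d\<^sup>2"
      by (simp add: K_def algebra_simps)
    show ?thesis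
      using upper lower 1 2 3 unfolding d_def[symmetric] by linarith
  qed
  have der: "(moreau_env \<eta> S g has_derivative (\<lambda>h. v \<bullet> h)) (at u within S)"
    unfolding has_derivative_within_alt
  proof (intro conjI allI impI)
    fix e :: real assume e: "e > 0"
    show "\<exists>d>0. \<forall>y\<in>S. norm (y - u) < d \<longrightarrow>
        norm (moreau_env \<eta> S g y - moreau_env \<eta> S g u - v \<bullet> (y - u)) \<le> e * norm (y - u)"
    proof (intro exI[of _ "e / K"] conjI ballI impI)
      fix y assume y: "y \<in> S" "norm (y - u) < e / K"
      then have "K * norm (y - u) * norm (y - u) \<le> e * norm (y - u)"
        using K by (intro mult_right_mono) (auto simp: field_simps)
      then show "norm (moreau_env \<eta> S g y - moreau_env \<eta> S g u - v \<bullet> (y - u)) \<le> e * norm (y - u)"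
        using bound[OF y(1)] by (simp add: power2_eq_square mult.assoc)
    qed (use e K in auto)
  qed (rule bounded_linear_inner_right)
  have "v + \<rho> *\<^sub>R P u \<in> convex_subdiff S (\<lambda>y. g y + \<rho> / 2 * (norm y)\<^sup>2) (P u)"
    unfolding convex_subdiff_def
  proof (intro CollectI conjI ballI)
    show "v + \<rho> *\<^sub>R P u \<in> S"
      unfolding v_def using S u P[OF u] by (intro subspace_add subspace_scale subspace_diff)
  next
    fix y assume y: "y \<in> S"
    \<comment> \<open>After expanding the squares, the growth inequality of strength
      \<open>c\<close> is exactly the subgradient inequality of the convexified function at
      \<open>P u\<close>.\<close>
    have "(?F u y - (?F u (P u) + c / 2 * (norm (y - P u))\<^sup>2))
        = g y + \<rho> / 2 * (norm y)\<^sup>2 - (g (P u) + \<rho> / 2 * (norm (P u))\<^sup>2 + (v + \<rho> *\<^sub>R P u) \<bullet> (y - P u))"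
      unfolding power2_norm_eq_inner v_def c_def
      by (simp add: inner_simps algebra_simps inner_commute diff_divide_distrib add_divide_distrib)
    then show "g (P u) + \<rho> / 2 * (norm (P u))\<^sup>2 + (v + \<rho> *\<^sub>R P u) \<bullet> (y - P u) \<le> g y + \<rho> / 2 * (norm y)\<^sup>2"
      using grow[OF u y] by linarith
  qed
  then have "v \<in> wc_subdiff \<rho> S g (P u)"
    unfolding wc_subdiff_def by (auto intro!: image_eqI[where x="v + \<rho> *\<^sub>R P u"])
  with der P[OF u] show ?thesis unfolding v_def by blast
qed

section \<open>Gradients within a subspace and one-sided directional derivatives\<close>

text \<open>The derivative within \<open>S\<close> fixes a gradient only up to vectors orthogonal to
  \<open>S\<close>; membership in \<open>S\<close> makes the description in \<open>grad_on\<close>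
  unique. Two candidates are compared along the line in the direction of their difference, which
  lies in \<open>S\<close>.\<close>

lemma grad_on_eqI:
  fixes g :: "'v::euclidean_space \<Rightarrow> real"
  assumes S: "subspace S" and u: "u \<in> S" and v: "v \<in> S"
    and der: "(g has_derivative (\<lambda>h. v \<bullet> h)) (at u within S)"
  shows "grad_on S g u = v"
  unfolding grad_on_def
proof (rule the_equality)
  fix w assume w: "w \<in> S \<and> (g has_derivative (\<lambda>h. w \<bullet> h)) (at u within S)"
  define d where "d = w - v"
  have d: "d \<in> S" using S w v by (simp add: d_def subspace_diff)
  have line: "((\<lambda>t::real. g (u + t *\<^sub>R d)) has_derivative (\<lambda>t. a \<bullet> (t *\<^sub>R d))) (at 0)"
    if "(g has_derivative (\<lambda>h. a \<bullet> h)) (at u within S)" for a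
  proof (rule has_derivative_in_compose[where f="\<lambda>t. u + t *\<^sub>R d" and g=g])
    show "((\<lambda>t. u + t *\<^sub>R d) has_derivative (\<lambda>t. t *\<^sub>R d)) (at 0)"
      by (auto intro!: derivative_eq_intros)
    show "(g has_derivative (\<lambda>h. a \<bullet> h)) (at (u + 0 *\<^sub>R d) within range (\<lambda>t. u + t *\<^sub>R d))"
      using that S u d by (auto intro!: has_derivative_subset[OF that] subspace_add subspace_scale)
  qed
  have "(\<lambda>t::real. w \<bullet> (t *\<^sub>R d)) = (\<lambda>t. v \<bullet> (t *\<^sub>R d))"
    using has_derivative_unique[OF line line] w der by blast
  from fun_cong[OF this, of 1] have "d \<bullet> d = 0"
    by (simp add: d_def inner_simps)
  then show "w = v" by (simp add: d_def)
qed (use v der in blast)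

text \<open>By convexity the difference quotients are nondecreasing in \<open>t\<close>, and the
  subgradient bounds them below, so their infimum is the limit.\<close>

lemma convex_directional_derivative:
  fixes h :: "'v::real_inner \<Rightarrow> real"
  assumes h: "convex_on S h" and u: "u \<in> S" and ray: "\<And>t. t \<ge> 0 \<Longrightarrow> u + t *\<^sub>R d \<in> S"
    and sub: "\<And>y. y \<in> S \<Longrightarrow> h u + b \<bullet> (y - u) \<le> h y"
  shows "\<exists>l. ((\<lambda>t. (h (u + t *\<^sub>R d) - h u) / t) \<longlongrightarrow> l) (at_right 0) \<and> b \<bullet> d \<le> l"
proof -
  define q where "q t = (h (u + t *\<^sub>R d) - h u) / t" for t
  have lb: "b \<bullet> d \<le> q t" if "t > 0" for t
    using sub[OF ray, of t] that by (simp add: q_def field_simps)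
  have mono: "q s \<le> q t" if st: "0 < s" "s \<le> t" for s t
  proof -
    have "u + s *\<^sub>R d = (1 - s / t) *\<^sub>R u + (s / t) *\<^sub>R (u + t *\<^sub>R d)"
      using st by (simp add: algebra_simps)
    then have "h (u + s *\<^sub>R d) \<le> (1 - s / t) * h u + (s / t) * h (u + t *\<^sub>R d)"
      using convex_onD[OF h, of "s / t" u "u + t *\<^sub>R d"] st u ray[of t] by simp
    then show ?thesis
      using st by (simp add: q_def field_simps)
  qed
  define l where "l = Inf (q ` {0<..})"
  have bdd: "bdd_below (q ` {0<..})"
    using lb by (intro bdd_belowI[of _ "b \<bullet> d"]) auto
  have l_le: "l \<le> q t" if "t > 0" for t
    unfolding l_def using that bdd by (intro cInf_lower) auto
  have "(q \<longlongrightarrow> l) (at_right 0)"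
  proof (rule order_tendstoI)
    fix a assume "a < l"
    then show "eventually (\<lambda>t. a < q t) (at_right 0)"
      using l_le by (force simp: eventually_at_right_field intro: exI[of _ 1])
  next
    fix a assume "l < a"
    then obtain t where t: "t > 0" "q t < a"
      using cInf_lessD[of "q ` {0<..}" a] by (auto simp: l_def)
    then have "q s < a" if "0 < s" "s < t" for s
      using mono[of s t] that by linarith
    then show "eventually (\<lambda>t. q t < a) (at_right 0)"
      using t(1) unfolding eventually_at_right_field by blast
  qed
  moreover have "b \<bullet> d \<le> l"
    unfolding l_def using lb by (intro cInf_greatest) auto
  ultimately show ?thesis unfolding q_def by blast
qed

lemma weakly_convex_directional_derivative:
  fixes g :: "'v::euclidean_space \<Rightarrow> real"
  assumes S: "subspace S" and g: "weakly_convex_on \<rho> S g" and u: "u \<in> S" and d: "d \<in> S"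
    and b: "b \<in> wc_subdiff \<rho> S g u"
  shows "\<exists>l. ((\<lambda>t. (g (u + t *\<^sub>R d) - g u) / t) \<longlongrightarrow> l) (at_right 0) \<and> b \<bullet> d \<le> l"
proof -
  let ?h = "\<lambda>y. g y + \<rho> / 2 * (norm y)\<^sup>2"
  have sub: "?h u + (b + \<rho> *\<^sub>R u) \<bullet> (y - u) \<le> ?h y" if "y \<in> S" for y
    using b that by (auto simp: wc_subdiff_def convex_subdiff_def)
  have "u + t *\<^sub>R d \<in> S" for t
    using S u d by (intro subspace_add subspace_scale)
  then obtain l where l: "((\<lambda>t. (?h (u + t *\<^sub>R d) - ?h u) / t) \<longlongrightarrow> l) (at_right 0)"
      "(b + \<rho> *\<^sub>R u) \<bullet> d \<le> l"
    using convex_directional_derivative[of S ?h u d "b + \<rho> *\<^sub>R u"] g u sub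
    unfolding weakly_convex_on_def by blast
  \<comment> \<open>The quotient of the quadratic term is explicit. Subtracting it turns the
    quotient of \<open>?h\<close> into that of \<open>g\<close>, and its limit
    \<open>\<rho> * (u \<bullet> d)\<close> cancels the shift built into
    \<open>wc_subdiff\<close>.\<close>
  have "((\<lambda>t. (?h (u + t *\<^sub>R d) - ?h u) / t - (\<rho> * (u \<bullet> d) + t * (\<rho> / 2 * (d \<bullet> d))))
      \<longlongrightarrow> l - (\<rho> * (u \<bullet> d) + 0 * (\<rho> / 2 * (d \<bullet> d)))) (at_right 0)"
    by (intro tendsto_intros l)
  moreover have "eventually (\<lambda>t. (?h (u + t *\<^sub>R d) - ?h u) / t - (\<rho> * (u \<bullet> d) + t * (\<rho> / 2 * (d \<bullet> d)))
      = (g (u + t *\<^sub>R d) - g u) / t) (at_right 0)"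
    unfolding eventually_at_right_field
  proof (intro exI[of _ 1] conjI allI impI)
    fix t :: real assume "0 < t" "t < 1"
    then show "(?h (u + t *\<^sub>R d) - ?h u) / t - (\<rho> * (u \<bullet> d) + t * (\<rho> / 2 * (d \<bullet> d)))
      = (g (u + t *\<^sub>R d) - g u) / t"
      unfolding power2_norm_eq_inner
      by (simp add: inner_simps field_simps inner_commute)
  qed simp
  ultimately have "((\<lambda>t. (g (u + t *\<^sub>R d) - g u) / t) \<longlongrightarrow> l - \<rho> * (u \<bullet> d)) (at_right 0)"
    by (simp add: tendsto_cong)
  moreover have "b \<bullet> d \<le> l - \<rho> * (u \<bullet> d)"
    using l(2) by (simp add: inner_simps)
  ultimately show ?thesis by blast
qed

section \<open>Perturbed contractions\<close>

lemma norm_star_eq_norm_vec: "norm_star x = norm (\<chi> i. x i)"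
  by (simp add: norm_star_def norm_vec_def L2_set_def)

lemma perturbed_contraction_tendsto_zero:
  fixes e d :: "nat \<Rightarrow> real"
  assumes q: "0 \<le> q" "q < 1" and e: "\<And>k. 0 \<le> e k" "\<And>k. e (Suc k) \<le> q * e k + d k"
    and d: "d \<longlonglongrightarrow> 0"
  shows "e \<longlonglongrightarrow> 0"
proof (rule LIMSEQ_I)
  fix r :: real assume r: "r > 0"
  define \<delta> where "\<delta> = r / 2"
  have \<delta>: "\<delta> > 0" using r by (simp add: \<delta>_def)
  have "0 < (1 - q) * \<delta>" using q \<delta> by simp
  then obtain N where N: "\<And>k. k \<ge> N \<Longrightarrow> d k < (1 - q) * \<delta>"
    using order_tendstoD(2)[OF d] unfolding eventually_sequentially by blast
  \<comment> \<open>The bound \<open>(1 - q) * \<delta>\<close> on the perturbation makes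
    \<open>\<delta>\<close> the fixed point of the majorising recursion, so the excess over
    \<open>\<delta>\<close> decays geometrically.\<close>
  have geo: "e (N + m) \<le> \<delta> + q ^ m * e N" for m
  proof (induction m)
    case 0
    then show ?case using \<delta> by simp
  next
    case (Suc m)
    have "e (N + Suc m) \<le> q * e (N + m) + (1 - q) * \<delta>"
      using e(2)[of "N + m"] N[of "N + m"] by simp
    also have "\<dots> \<le> q * (\<delta> + q ^ m * e N) + (1 - q) * \<delta>"
      using Suc q by (intro add_right_mono mult_left_mono)
    finally show ?case by (simp add: algebra_simps)
  qed
  have "(\<lambda>m. q ^ m * e N) \<longlonglongrightarrow> 0"
    using q by (intro tendsto_mult_left_zero LIMSEQ_power_zero) auto
  from order_tendstoD(2)[OF this \<delta>] obtain K where K: "\<And>m. m \<ge> K \<Longrightarrow> q ^ m * e N < \<delta>"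
    unfolding eventually_sequentially by blast
  have "norm (e n - 0) < r" if "n \<ge> N + K" for n
  proof -
    have "N + (n - N) = n" "K \<le> n - N" using that by auto
    then show ?thesis
      using geo[of "n - N"] K[of "n - N"] e(1)[of n] by (simp add: \<delta>_def)
  qed
  then show "\<exists>no. \<forall>n\<ge>no. norm (e n - 0) < r" by blast
qed

text \<open>Exchanging sum and integral gives the series of squares a finite expectation, so it
  converges almost surely and its terms vanish.\<close>

lemma AE_tendsto_zero_if_second_moments_summable:
  fixes Z :: "nat \<Rightarrow> 'w \<Rightarrow> real"
  assumes [measurable]: "\<And>k. Z k \<in> borel_measurable M"
    and le: "\<And>k. (\<integral>\<^sup>+\<omega>. ennreal ((Z k \<omega>)\<^sup>2) \<partial>M) \<le> ennreal (c k)"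
    and c: "\<And>k. 0 \<le> c k" "summable c"
  shows "AE \<omega> in M. (\<lambda>k. Z k \<omega>) \<longlonglongrightarrow> 0"
proof -
  have "(\<integral>\<^sup>+\<omega>. (\<Sum>k. ennreal ((Z k \<omega>)\<^sup>2)) \<partial>M) = (\<Sum>k. \<integral>\<^sup>+\<omega>. ennreal ((Z k \<omega>)\<^sup>2) \<partial>M)"
    by (rule nn_integral_suminf) measurable
  also have "\<dots> \<le> (\<Sum>k. ennreal (c k))"
    by (intro suminf_le le) auto
  also have "\<dots> = ennreal (\<Sum>k. c k)"
    by (rule suminf_ennreal2[OF c])
  finally have "(\<integral>\<^sup>+\<omega>. (\<Sum>k. ennreal ((Z k \<omega>)\<^sup>2)) \<partial>M) \<noteq> \<infinity>"
    by (auto simp: top_unique)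
  then have "AE \<omega> in M. (\<Sum>k. ennreal ((Z k \<omega>)\<^sup>2)) \<noteq> \<infinity>"
    by (intro nn_integral_PInf_AE) measurable
  then show ?thesis
  proof eventually_elim
    case (elim \<omega>)
    then have "summable (\<lambda>k. (Z k \<omega>)\<^sup>2)"
      by (intro summable_suminf_not_top) auto
    then have "(\<lambda>k. sqrt ((Z k \<omega>)\<^sup>2)) \<longlonglongrightarrow> sqrt 0"
      by (intro tendsto_real_sqrt summable_LIMSEQ_zero)
    then show ?case by (simp add: tendsto_rabs_zero_iff)
  qed
qed

section \<open>Best responses in the smoothed game\<close>

text \<open>Proximal points are taken over \<open>S i\<close> and may leave \<open>X i\<close>;
  hence weak convexity is stated on the subspaces, while equilibria and best responses live in
  \<open>X\<close>.\<close>

locale smoothed_game =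
  fixes S X :: "'p::finite \<Rightarrow> 'v::euclidean_space set"
    and f :: "'p \<Rightarrow> ('p \<Rightarrow> 'v) \<Rightarrow> real"
    and \<rho> Lh Lm :: "'p \<Rightarrow> real"
    and \<eta> \<mu> :: real
  assumes S: "\<And>i. subspace (S i)"
    and X: "\<And>i. X i \<noteq> {} \<and> closed (X i) \<and> convex (X i) \<and> X i \<subseteq> S i"
    and wc: "\<And>i x. x \<in> profiles S \<Longrightarrow> weakly_convex_on (\<rho> i) (S i) (\<lambda>y. f i (x(i := y)))"
    and rho_pos: "\<And>i. \<rho> i > 0"
    and eta: "\<eta> > 0" "\<And>i. \<eta> < 1 / \<rho> i"
    and mu: "\<mu> > 0"
    and C1: "\<And>i xi y w. xi \<in> X i \<Longrightarrow> y \<in> profiles X \<Longrightarrow> w \<in> profiles X \<Longrightarrow>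
               norm (grad_on (S i) (\<lambda>z. fhat S f \<eta> \<mu> i z y) xi
                     - grad_on (S i) (\<lambda>z. fhat S f \<eta> \<mu> i z w) xi)
               \<le> Lh i * norm (y i - w i) + Lm i * norm_minus i (\<lambda>j. y j - w j)"
    and C2: "spectral_norm (Gamma2 Lh Lm \<mu>) < 1"
begin

abbreviation G :: "'p \<Rightarrow> ('p \<Rightarrow> 'v) \<Rightarrow> 'v" where
  "G i x \<equiv> pgrad S (fenv S f \<eta> i) i x"

abbreviation BR :: "'p \<Rightarrow> ('p \<Rightarrow> 'v) \<Rightarrow> 'v" where
  "BR \<equiv> bresp S X f \<eta> \<mu>"

abbreviation \<Gamma> :: "real^'p^'p" where
  "\<Gamma> \<equiv> Gamma2 Lh Lm \<mu>"

lemma profiles_X_subset_S: "x \<in> profiles X \<Longrightarrow> x \<in> profiles S"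
  using X by (force simp: profiles_def)

text \<open>One proximal point \<open>p\<close> carries both facts: its distance to
  \<open>x i\<close> is \<open>\<eta>\<close> times the gradient norm, and the smoothed gradient is
  a subgradient of the original cost there. The passage back to the original game uses the two
  together.\<close>

lemma pgrad_prox:
  assumes x: "x \<in> profiles S"
  shows "\<exists>p\<in>S i. G i x = (1 / \<eta>) *\<^sub>R (x i - p) \<and> G i x \<in> wc_subdiff (\<rho> i) (S i) (\<lambda>y. f i (x(i := y))) p"
proof -
  have xi: "x i \<in> S i" using x by (simp add: profiles_def)
  have "\<eta> * \<rho> i < 1"
    using eta(2)[of i] rho_pos[of i] by (simp add: field_simps)
  then obtain p where p: "p \<in> S i"
    "(moreau_env \<eta> (S i) (\<lambda>y. f i (x(i := y))) has_derivative (\<lambda>h. ((1 / \<eta>) *\<^sub>R (x i - p)) \<bullet> h)) (at (x i) within S i)"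
    "(1 / \<eta>) *\<^sub>R (x i - p) \<in> wc_subdiff (\<rho> i) (S i) (\<lambda>y. f i (x(i := y))) p"
    using moreau_env_has_derivative[OF S wc[OF x] eta(1) _ xi] by blast
  have "(1 / \<eta>) *\<^sub>R (x i - p) \<in> S i"
    using S xi p by (intro subspace_scale subspace_diff)
  then have "G i x = (1 / \<eta>) *\<^sub>R (x i - p)"
    unfolding pgrad_def fenv_def using grad_on_eqI[OF S xi _ p(2)] by simp
  with p show ?thesis by auto
qed

lemma pgrad_in_S: "x \<in> profiles S \<Longrightarrow> G i x \<in> S i"
  using pgrad_prox[of x i] S[of i] by (auto simp: profiles_def intro!: subspace_scale subspace_diff)

lemma grad_fhat:
  assumes y: "y \<in> profiles S" and z: "z \<in> S i"
  shows "grad_on (S i) (\<lambda>z. fhat S f \<eta> \<mu> i z y) z = G i y + \<mu> *\<^sub>R (z - y i)"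
proof (rule grad_on_eqI[OF S z])
  show "G i y + \<mu> *\<^sub>R (z - y i) \<in> S i"
    using y z S[of i] pgrad_in_S[OF y] 
    by (auto simp: profiles_def intro!: subspace_add subspace_scale subspace_diff)
  show "((\<lambda>z. fhat S f \<eta> \<mu> i z y) has_derivative (\<bullet>) (G i y + \<mu> *\<^sub>R (z - y i))) (at z within S i)"
    unfolding fhat_def power2_norm_eq_inner
    by (auto intro!: derivative_eq_intros simp: fun_eq_iff inner_simps algebra_simps inner_commute)
qed

text \<open>Completing the square turns the surrogate into a constant plus \<open>\<mu> / 2\<close>
  times the squared distance to \<open>a\<close>. Existence and uniqueness of closest points in a
  closed convex set then justify the definite description in \<open>bresp\<close>.\<close>

lemma bresp_eq_closest_point:
  "BR i y = closest_point (X i) (y i - (1 / \<mu>) *\<^sub>R G i y)"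
proof -
  define a where "a = y i - (1 / \<mu>) *\<^sub>R G i y"
  have "fhat S f \<eta> \<mu> i z y = fenv S f \<eta> i y - 1 / (2 * \<mu>) * (norm (G i y))\<^sup>2 + \<mu> / 2 * (dist a z)\<^sup>2" for z
    unfolding fhat_def a_def dist_norm power2_norm_eq_inner using mu
    by (simp add: inner_simps field_simps inner_commute)
  then have "fhat S f \<eta> \<mu> i z y \<le> fhat S f \<eta> \<mu> i w y \<longleftrightarrow> dist a z \<le> dist a w" for z w
    using mu by (simp add: mult_le_cancel_left_pos)
  then have "BR i y = (THE z. z \<in> X i \<and> (\<forall>w\<in>X i. dist a z \<le> dist a w))"
    by (simp add: bresp_def)
  also have "\<dots> = closest_point (X i) a"
    using X[of i] closest_point_exists[of "X i" a]
    by (intro the_equality) (auto intro!: closest_point_unique)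
  finally show ?thesis by (simp add: a_def)
qed

lemma bresp_in_X: "BR i y \<in> X i"
  using X[of i] by (simp add: bresp_eq_closest_point closest_point_in_set)

text \<open>No sign is imposed on \<open>Lm i\<close>; if it is negative, the Lipschitz bound at profiles with equal
  \<open>i\<close>-th component forces every other strategy set to be a singleton.\<close>
lemma Lm_norm_minus_le:
  assumes y: "y \<in> profiles X" and w: "w \<in> profiles X"
  shows "Lm i * norm_minus i (\<lambda>j. y j - w j) \<le> Lm i * (\<Sum>j\<in>UNIV - {i}. norm (y j - w j))"
proof (cases "Lm i \<ge> 0")
  case True
  have "norm_minus i (\<lambda>j. y j - w j) \<le> (\<Sum>j\<in>UNIV - {i}. norm (y j - w j))"
    using L2_set_le_sum[of "UNIV - {i}" "\<lambda>j. norm (y j - w j)"] by (simp add: norm_minus_def L2_set_def)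
  then show ?thesis using True by (rule mult_left_mono)
next
  case False
  have "y j = w j" if j: "j \<noteq> i" for j
  proof (rule ccontr)
    assume ne: "y j \<noteq> w j"
    define v where "v = w(i := y i)"
    have v: "v \<in> profiles X" using y w by (auto simp: v_def profiles_def)
    have "(norm (y j - v j))\<^sup>2 \<le> (\<Sum>j\<in>UNIV - {i}. (norm (y j - v j))\<^sup>2)"
      using j by (intro member_le_sum) auto
    moreover have "0 < (norm (y j - v j))\<^sup>2" using ne j by (simp add: v_def)
    ultimately have "0 < norm_minus i (\<lambda>j. y j - v j)"
      unfolding norm_minus_def by (intro iffD2[OF real_sqrt_gt_0_iff]) (rule less_le_trans)
    then have "Lm i * norm_minus i (\<lambda>j. y j - v j) < 0"
      using False by (simp add: mult_neg_pos)
    moreover have "y i \<in> X i" using y by (simp add: profiles_def)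
    ultimately show False
      using C1[OF _ y v, of "y i" i] by (simp add: v_def) (smt (verit) norm_ge_zero)
  qed
  then show ?thesis by (simp add: norm_minus_def)
qed

text \<open>Projection onto a closed convex set is nonexpansive, so it suffices to compare the two
  gradient steps, and this is what \<open>C1\<close> controls.\<close>

lemma bresp_diff_le_Gamma:
  assumes y: "y \<in> profiles X" and w: "w \<in> profiles X"
  shows "norm (BR i y - BR i w) \<le> (\<Gamma> *v (\<chi> j. norm (y j - w j))) $ i"
proof -
  note yS = profiles_X_subset_S[OF y] and wS = profiles_X_subset_S[OF w]
  obtain z where z: "z \<in> X i" using X by blast
  then have zS: "z \<in> S i" using X by blast
  \<comment> \<open>By \<open>grad_fhat\<close> the surrogate gradients at a common \<open>z\<close>
    differ by \<open>- \<mu>\<close> times the difference of the gradient steps. This does not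
    depend on \<open>z\<close>, so any point of \<open>X i\<close> serves.\<close>
  have eq: "(y i - (1 / \<mu>) *\<^sub>R G i y) - (w i - (1 / \<mu>) *\<^sub>R G i w)
      = - (1 / \<mu>) *\<^sub>R (grad_on (S i) (\<lambda>z. fhat S f \<eta> \<mu> i z y) z - grad_on (S i) (\<lambda>z. fhat S f \<eta> \<mu> i z w) z)"
    unfolding grad_fhat[OF yS zS] grad_fhat[OF wS zS] using mu by (simp add: algebra_simps)
  have "norm (BR i y - BR i w) \<le> norm ((y i - (1 / \<mu>) *\<^sub>R G i y) - (w i - (1 / \<mu>) *\<^sub>R G i w))"
    using closest_point_lipschitz[of "X i"] X[of i] by (simp add: bresp_eq_closest_point dist_norm)
  also have "\<dots> = 1 / \<mu> * norm (grad_on (S i) (\<lambda>z. fhat S f \<eta> \<mu> i z y) z - grad_on (S i) (\<lambda>z. fhat S f \<eta> \<mu> i z w) z)"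
    unfolding eq norm_scaleR using mu by simp
  also have "\<dots> \<le> 1 / \<mu> * (Lh i * norm (y i - w i) + Lm i * norm_minus i (\<lambda>j. y j - w j))"
    using mu C1[OF z y w] by (intro mult_left_mono) auto
  \<comment> \<open>The Euclidean norm over the other players gives way to the sum of their norms,
    which is the form produced by row \<open>i\<close> of the matrix.\<close>
  also have "\<dots> \<le> 1 / \<mu> * (Lh i * norm (y i - w i) + Lm i * (\<Sum>j\<in>UNIV - {i}. norm (y j - w j)))"
    using mu Lm_norm_minus_le[OF y w, of i] by (intro mult_left_mono) auto
  also have "\<dots> = (\<Gamma> *v (\<chi> j. norm (y j - w j))) $ i"
    by (simp add: matrix_vector_mult_def Gamma2_def sum.remove[of UNIV i] sum_distrib_left
        add_divide_distrib sum_divide_distrib)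
  finally show ?thesis .
qed

text \<open>\<open>norm_star\<close> is the Euclidean norm of the vector of component norms.
  Domination of nonnegative entries passes to that norm, and the operator norm of the matrix does
  the rest.\<close>

lemma bresp_contraction:
  assumes y: "y \<in> profiles X" and w: "w \<in> profiles X"
  shows "norm_star (\<lambda>i. BR i y - BR i w) \<le> spectral_norm \<Gamma> * norm_star (\<lambda>i. y i - w i)"
proof -
  let ?v = "\<chi> j. norm (y j - w j)"
  have "norm_star (\<lambda>i. BR i y - BR i w) = norm (\<chi> i. norm (BR i y - BR i w))"
    by (simp add: norm_star_def norm_vec_def L2_set_def)
  also have "\<dots> \<le> norm (\<Gamma> *v ?v)"
  proof (rule norm_le_componentwise_cart)
    show "norm ((\<chi> i. norm (BR i y - BR i w)) $ i) \<le> norm ((\<Gamma> *v ?v) $ i)" for i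
      using order_trans[OF bresp_diff_le_Gamma[OF y w, of i] abs_ge_self] by simp
  qed
  also have "\<dots> \<le> spectral_norm \<Gamma> * norm ?v"
    unfolding spectral_norm_def by (rule onorm) simp
  also have "norm ?v = norm_star (\<lambda>i. y i - w i)"
    by (simp add: norm_star_def norm_vec_def L2_set_def)
  finally show ?thesis .
qed

lemma spectral_norm_nonneg: "0 \<le> spectral_norm \<Gamma>"
  unfolding spectral_norm_def by (rule onorm_pos_le) simp

section \<open>Fixed points and equilibria of the smoothed game\<close>

text \<open>Profiles as vectors: the Euclidean norm on \<open>'v^'p\<close> is
  \<open>norm_star\<close>, so the best response contracts \<open>dist\<close> on a closed subset of
  a complete space. Banach's theorem and continuity of Lipschitz maps then apply.\<close>

definition XV :: "('v^'p) set" where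
  "XV = {x. \<forall>i. x $ i \<in> X i}"

lemma XV_iff: "x \<in> XV \<longleftrightarrow> ($) x \<in> profiles X"
  by (simp add: XV_def profiles_def)

lemma bresp_lipschitz_XV:
  assumes "x \<in> XV" "y \<in> XV"
  shows "dist (\<chi> i. BR i (($) x)) (\<chi> i. BR i (($) y)) \<le> spectral_norm \<Gamma> * dist x y"
proof -
  have "(\<chi> i. BR i (($) x)) - (\<chi> i. BR i (($) y)) = (\<chi> i. BR i (($) x) - BR i (($) y))"
    "x - y = (\<chi> i. x $ i - y $ i)"
    by (simp_all add: vec_eq_iff)
  then show ?thesis
    using bresp_contraction[of "($) x" "($) y"] assms by (simp add: dist_norm norm_star_eq_norm_vec XV_iff)
qed

lemma bresp_unique_fixed_point: "\<exists>xs\<in>profiles X. \<forall>x\<in>profiles X. (\<lambda>i. BR i x) = x \<longleftrightarrow> x = xs"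
proof -
  have "closed XV"
    unfolding XV_def using X by (intro closed_Collect_all closed_vimage_vec_nth[unfolded vimage_def]) auto
  moreover have "(\<chi> i. SOME z. z \<in> X i) \<in> XV"
    using X by (auto simp: XV_def some_in_eq)
  then have "XV \<noteq> {}" by blast
  ultimately have "\<exists>!x\<in>XV. (\<chi> i. BR i (($) x)) = x"
    by (intro Banach_fix[where c = "spectral_norm \<Gamma>"] spectral_norm_nonneg C2 bresp_lipschitz_XV)
      (auto simp: bresp_in_X complete_eq_closed XV_iff profiles_def)
  then obtain v where v: "v \<in> XV" "(\<chi> i. BR i (($) v)) = v"
    and uniq: "\<And>x. x \<in> XV \<Longrightarrow> (\<chi> i. BR i (($) x)) = x \<Longrightarrow> x = v"
    by blast
  have "(\<lambda>i. BR i x) = x \<longleftrightarrow> x = ($) v" if x: "x \<in> profiles X" for x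
  proof
    assume fixed: "(\<lambda>i. BR i x) = x"
    then have "(\<chi> i. x i) = v"
      using x by (intro uniq) (simp_all add: XV_iff vec_eq_iff fun_eq_iff vec_lambda_inverse)
    then show "x = ($) v" by auto
  next
    assume "x = ($) v"
    moreover have "BR i (($) v) = v $ i" for i using v(2) by (simp add: vec_eq_iff)
    ultimately show "(\<lambda>i. BR i x) = x" by (simp only:)
  qed
  then show ?thesis using v(1) by (auto simp: XV_iff)
qed

text \<open>Being the projection of \<open>a\<close> is characterised by a variational inequality.
  As \<open>a - x i\<close> is a negative multiple of \<open>G i x\<close>, that inequality is the
  equilibrium condition.\<close>

lemma smoothed_QNE_iff_fixed_point:
  "smoothed_QNE S X f \<eta> x \<longleftrightarrow> x \<in> profiles X \<and> (\<lambda>i. BR i x) = x"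
proof -
  have "BR i x = x i \<longleftrightarrow> (\<forall>z\<in>X i. 0 \<le> G i x \<bullet> (z - x i))" if x: "x \<in> profiles X" for i
  proof -
    define a where "a = x i - (1 / \<mu>) *\<^sub>R G i x"
    have xi: "x i \<in> X i" using x by (simp add: profiles_def)
    have dot: "(a - x i) \<bullet> (z - x i) \<le> 0 \<longleftrightarrow> 0 \<le> G i x \<bullet> (z - x i)" for z
      using mu by (simp add: a_def zero_le_divide_iff)
    have "closest_point (X i) a = x i \<longleftrightarrow> (\<forall>z\<in>X i. (a - x i) \<bullet> (z - x i) \<le> 0)"
    proof
      assume "closest_point (X i) a = x i"
      then show "\<forall>z\<in>X i. (a - x i) \<bullet> (z - x i) \<le> 0"
        using closest_point_dot[of "X i" _ a] X[of i] by auto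
    next
      assume *: "\<forall>z\<in>X i. (a - x i) \<bullet> (z - x i) \<le> 0"
      have "dist a (x i) \<le> dist a z" if z: "z \<in> X i" for z
      proof -
        \<comment> \<open>Converse of \<open>closest_point_dot\<close>: a nonpositive inner product
          can only increase the distance from \<open>a\<close> when \<open>x i\<close> is replaced
          by \<open>z\<close>.\<close>
        have "(norm (a - z))\<^sup>2 = (norm (a - x i))\<^sup>2 - 2 * ((a - x i) \<bullet> (z - x i)) + (norm (z - x i))\<^sup>2"
          unfolding power2_norm_eq_inner by (simp add: inner_simps inner_commute)
        then have "(norm (a - x i))\<^sup>2 \<le> (norm (a - z))\<^sup>2"
          using * z by (smt (verit) zero_le_power2)
        then show ?thesis unfolding dist_norm by (rule power2_le_imp_le) simp
      qed
      then show "closest_point (X i) a = x i"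
        using closest_point_unique[of "X i" "x i" a] X[of i] xi by auto
    qed
    then show ?thesis by (simp add: bresp_eq_closest_point a_def[symmetric] dot)
  qed
  then show ?thesis by (auto simp: smoothed_QNE_def fun_eq_iff)
qed

section \<open>Approximate equilibrium of the original game\<close>

text \<open>The subgradient \<open>G i x\<close> at the proximal point has a neighbour
  \<open>b\<close> in the subdifferential at \<open>x i\<close>. Replacing \<open>G i x\<close> by
  \<open>b\<close> in the variational inequality costs at most their distance times the diameter,
  and \<open>b\<close> bounds the directional derivative from below.\<close>

lemma smoothed_QNE_imp_eps_QNE:
  assumes qne: "smoothed_QNE S X f \<eta> x" and cpt: "\<And>i. compact (X i)"
    and lip: "\<And>i. setval_lipschitz_on (S i) (L i) (wc_subdiff (\<rho> i) (S i) (\<lambda>y. f i (x(i := y))))"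
  shows "eps_QNE X f (\<eta> * (MAX i. L i) * (MAX i. diameter (X i)) * (MAX i. norm (G i x))) x"
proof -
  have x: "x \<in> profiles X" and vi: "\<And>i z. z \<in> X i \<Longrightarrow> 0 \<le> G i x \<bullet> (z - x i)"
    using qne by (auto simp: smoothed_QNE_def)
  note xS = profiles_X_subset_S[OF x]
  define Lmax D Mmax where "Lmax = (MAX i. L i)" and "D = (MAX i. diameter (X i))"
    and "Mmax = (MAX i. norm (G i x))"
  have max: "L i \<le> Lmax" "diameter (X i) \<le> D" "norm (G i x) \<le> Mmax" for i
    by (auto simp: Lmax_def D_def Mmax_def)
  have sub: "\<exists>b \<in> wc_subdiff (\<rho> i) (S i) (\<lambda>y. f i (x(i := y))) (x i). norm (G i x - b) \<le> L i * (\<eta> * norm (G i x))" for i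
  proof -
    obtain p where p: "p \<in> S i" "G i x = (1 / \<eta>) *\<^sub>R (x i - p)"
      "G i x \<in> wc_subdiff (\<rho> i) (S i) (\<lambda>y. f i (x(i := y))) p"
      using pgrad_prox[OF xS] by blast
    have "x i \<in> S i" using xS by (simp add: profiles_def)
    then obtain b where b: "b \<in> wc_subdiff (\<rho> i) (S i) (\<lambda>y. f i (x(i := y))) (x i)"
      "norm (G i x - b) \<le> L i * norm (p - x i)"
      using lip[of i] p unfolding setval_lipschitz_on_def by blast
    have "norm (p - x i) = \<eta> * norm (G i x)"
      using p(2) eta(1) by (simp add: norm_minus_commute)
    with b show ?thesis by auto
  qed
  \<comment> \<open>\<open>L i\<close> may be negative, but the bound in \<open>sub\<close>
    dominates a norm, which forces this product to be nonnegative.\<close>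
  have LG_nonneg: "0 \<le> L i * norm (G i x)" for i
  proof -
    have "0 \<le> L i * (\<eta> * norm (G i x))" using sub[of i] norm_ge_zero order_trans by blast
    then have "0 \<le> \<eta> * (L i * norm (G i x))" by (simp add: mult.left_commute)
    then show ?thesis using eta(1) by (simp add: zero_le_mult_iff[of \<eta>])
  qed
  \<comment> \<open>The two maxima may be attained by different players. If \<open>Lmax\<close> is
    negative, all gradients vanish and both sides are \<open>0\<close>.\<close>
  have LG_le: "L i * norm (G i x) \<le> Lmax * Mmax" for i
  proof (cases "0 \<le> Lmax")
    case True
    have "L i * norm (G i x) \<le> Lmax * norm (G i x)" using max by (intro mult_right_mono) auto
    also have "\<dots> \<le> Lmax * Mmax" using max True by (intro mult_left_mono) auto
    finally show ?thesis .
  next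
    case False
    then have "L j < 0" for j using max(1)[of j] by simp
    then have zero: "norm (G j x) = 0" for j
      using LG_nonneg[of j] by (auto simp: zero_le_mult_iff not_le dest: less_imp_not_less) (meson leD)
    then have "Mmax = 0" by (simp add: Mmax_def)
    then show ?thesis using zero[of i] by simp
  qed
  have "\<exists>l. ((\<lambda>t. (f i (x(i := x i + t *\<^sub>R (z - x i))) - f i x) / t) \<longlongrightarrow> l) (at_right 0)
          \<and> - (\<eta> * Lmax * D * Mmax) \<le> l" if z: "z \<in> X i" for i z
  proof -
    obtain b where b: "b \<in> wc_subdiff (\<rho> i) (S i) (\<lambda>y. f i (x(i := y))) (x i)"
      "norm (G i x - b) \<le> L i * (\<eta> * norm (G i x))"
      using sub by blast
    have xi: "x i \<in> X i" "x i \<in> S i" using x xS by (auto simp: profiles_def)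
    have "z - x i \<in> S i" using X[of i] z xi S[of i] by (auto intro: subspace_diff)
    from weakly_convex_directional_derivative[OF S wc[OF xS] xi(2) this b(1)]
    obtain l where l: "((\<lambda>t. (f i (x(i := x i + t *\<^sub>R (z - x i))) - f i x) / t) \<longlongrightarrow> l) (at_right 0)"
      "b \<bullet> (z - x i) \<le> l" by auto
    have "norm (z - x i) \<le> D"
      using diameter_bounded_bound[OF compact_imp_bounded[OF cpt] z xi(1)] max(2)[of i]
      by (simp add: dist_norm)
    then have "norm (G i x - b) * norm (z - x i) \<le> (\<eta> * (L i * norm (G i x))) * D"
      using b(2) LG_nonneg[of i] eta(1) by (intro mult_mono) (auto simp: algebra_simps)
    also have "\<dots> \<le> (\<eta> * (Lmax * Mmax)) * D"
      using eta(1) LG_le[of i] \<open>norm (z - x i) \<le> D\<close> norm_ge_zero[of "z - x i"]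
      by (intro mult_right_mono mult_left_mono) (auto intro: order_trans[OF norm_ge_zero])
    finally have "norm (G i x - b) * norm (z - x i) \<le> \<eta> * Lmax * D * Mmax"
      by (simp add: algebra_simps)
    then have "(G i x - b) \<bullet> (z - x i) \<le> \<eta> * Lmax * D * Mmax"
      using norm_cauchy_schwarz order_trans by blast
    then have "- (\<eta> * Lmax * D * Mmax) \<le> b \<bullet> (z - x i)"
      using vi[OF z] by (simp add: inner_diff_left)
    with l show ?thesis by force
  qed
  then show ?thesis using x unfolding eps_QNE_def Lmax_def D_def Mmax_def by blast
qed

section \<open>Almost sure convergence of the random iterates\<close>

text \<open>Without measurability the conditional bound would be void: \<^const>\<open>nn_cond_exp\<close> returns \<open>0\<close> on non-measurable integrands.\<close>
lemma bresp_measurable: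
  assumes xi [measurable]: "\<xi> \<in> borel_measurable M" and range: "\<And>\<omega>. \<omega> \<in> space M \<Longrightarrow> \<xi> \<omega> \<in> profiles X"
  shows "(\<lambda>\<omega>. BR i (\<xi> \<omega>)) \<in> borel_measurable M"
proof -
  have "(spectral_norm \<Gamma>)-lipschitz_on XV (\<lambda>x. \<chi> i. BR i (($) x))"
    by (intro lipschitz_onI bresp_lipschitz_XV spectral_norm_nonneg)
  then have "continuous_on XV (\<lambda>x. (\<chi> i. BR i (($) x)) $ i)"
    by (intro continuous_on_component lipschitz_on_continuous_on)
  then have [measurable]: "(\<lambda>x. BR i (($) x)) \<in> borel_measurable (restrict_space borel XV)"
    using borel_measurable_continuous_on_restrict by fastforce
  \<comment> \<open>\<open>borel\<close> on profiles comes from the product topology, for which the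
    passage to \<open>'v^'p\<close> is continuous.\<close>
  have "continuous_on UNIV (\<lambda>y::'p \<Rightarrow> 'v. \<chi> j. y j)"
    by (intro continuous_on_vec_lambda continuous_on_product_coordinates)
  then have "(\<lambda>y::'p \<Rightarrow> 'v. \<chi> j. y j) \<in> borel_measurable borel"
    by (rule borel_measurable_continuous_onI)
  then have "(\<lambda>\<omega>. \<chi> j. \<xi> \<omega> j) \<in> borel_measurable M"
    by measurable
  then have "(\<lambda>\<omega>. \<chi> j. \<xi> \<omega> j) \<in> measurable M (restrict_space borel XV)"
    using range by (intro measurable_restrict_space2) (auto simp: XV_def profiles_def)
  from measurable_compose[OF this, of "\<lambda>x. BR i (($) x)" borel]
  show ?thesis by (simp add: vec_lambda_inverse)
qed

text \<open>Along almost every path the distance to \<open>xs\<close> obeys a perturbed contraction;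
  probability enters only through the almost sure vanishing of the errors \<open>Z\<close>.\<close>

lemma ms_ssbr_tendsto:
  assumes M: "prob_space M" and \<epsilon>: "\<And>i k. 0 \<le> \<epsilon> i k" "\<And>i. summable (\<epsilon> i)"
    and alg: "ms_ssbr M S X f \<eta> \<mu> \<epsilon> xk"
    and xs: "xs \<in> profiles X" "(\<lambda>i. BR i xs) = xs"
  shows "AE \<omega> in M. \<forall>i. (\<lambda>k. xk k \<omega> i) \<longlonglongrightarrow> xs i"
proof -
  interpret prob_space M by fact
  have meas [measurable]: "\<And>k. xk k \<in> borel_measurable M"
    and range: "\<And>k \<omega>. \<omega> \<in> space M \<Longrightarrow> xk k \<omega> \<in> profiles X"
    and cond: "\<And>k i. AE \<omega> in M. nn_cond_exp M (vimage_algebra (space M) (xk k) borel)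
          (\<lambda>\<omega>. ennreal ((norm (xk (Suc k) \<omega> i - BR i (xk k \<omega>)))\<^sup>2)) \<omega> \<le> ennreal ((\<epsilon> i k)\<^sup>2)"
    using alg by (auto simp: ms_ssbr_def)
  have [measurable]: "(\<lambda>\<omega>. xk k \<omega> i) \<in> borel_measurable M" for k i
    using measurable_compose[OF meas borel_measurable_continuous_onI[OF continuous_on_product_coordinates]] by simp
  have [measurable]: "(\<lambda>\<omega>. BR i (xk k \<omega>)) \<in> borel_measurable M" for k i
    by (intro bresp_measurable meas range)
  define Z where "Z i k \<omega> = norm (xk (Suc k) \<omega> i - BR i (xk k \<omega>))" for i k \<omega>
  have [measurable]: "Z i k \<in> borel_measurable M" for i k
    unfolding Z_def by measurable
  have mom: "(\<integral>\<^sup>+\<omega>. ennreal ((Z i k \<omega>)\<^sup>2) \<partial>M) \<le> ennreal ((\<epsilon> i k)\<^sup>2)" for i k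
  proof -
    define F where "F = vimage_algebra (space M) (xk k) borel"
    have "subalgebra M F"
      unfolding subalgebra_def F_def using meas[of k]
      by (auto simp: sets_vimage_algebra2 measurable_sets)
    then interpret finite_measure_subalgebra M F
      by unfold_locales
    \<comment> \<open>With the constant weight \<open>1\<close> this is the tower property, which
      turns the conditional bound into a bound on the second moment.\<close>
    have "(\<integral>\<^sup>+\<omega>. ennreal ((Z i k \<omega>)\<^sup>2) \<partial>M) = (\<integral>\<^sup>+\<omega>. nn_cond_exp M F (\<lambda>\<omega>. ennreal ((Z i k \<omega>)\<^sup>2)) \<omega> \<partial>M)"
      using nn_cond_exp_intg[of "\<lambda>_. 1" "\<lambda>\<omega>. ennreal ((Z i k \<omega>)\<^sup>2)"] by simp
    also have "\<dots> \<le> (\<integral>\<^sup>+\<omega>. ennreal ((\<epsilon> i k)\<^sup>2) \<partial>M)"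
      using cond[of k i] unfolding F_def Z_def by (rule nn_integral_mono_AE)
    also have "\<dots> = ennreal ((\<epsilon> i k)\<^sup>2)"
      by (simp add: emeasure_space_1)
    finally show ?thesis .
  qed
  \<comment> \<open>Eventually \<open>\<epsilon> i k < 1\<close>, and from then on the square is at
    most \<open>\<epsilon> i k\<close>.\<close>
  have summ: "summable (\<lambda>k. (\<epsilon> i k)\<^sup>2)" for i
  proof (rule summable_comparison_test_ev[OF _ \<epsilon>(2)])
    have "eventually (\<lambda>k. \<epsilon> i k < 1) sequentially"
      using order_tendstoD(2)[OF summable_LIMSEQ_zero[OF \<epsilon>(2)], of 1] by simp
    then show "eventually (\<lambda>k. norm ((\<epsilon> i k)\<^sup>2) \<le> \<epsilon> i k) sequentially"
      by eventually_elim (use \<epsilon>(1) in \<open>simp add: power2_eq_square mult_left_le less_imp_le\<close>)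
  qed
  have "AE \<omega> in M. \<forall>i. (\<lambda>k. Z i k \<omega>) \<longlonglongrightarrow> 0"
    by (subst AE_all_countable) (intro allI AE_tendsto_zero_if_second_moments_summable[OF _ mom _ summ]; simp)
  then show ?thesis
    using AE_space
  proof eventually_elim
    case (elim \<omega>)
    define e where "e k = norm_star (\<lambda>i. xk k \<omega> i - xs i)" for k
    define d where "d k = (\<Sum>i\<in>UNIV. Z i k \<omega>)" for k
    have e: "e \<longlonglongrightarrow> 0"
    proof (rule perturbed_contraction_tendsto_zero)
      show "0 \<le> spectral_norm \<Gamma>" "spectral_norm \<Gamma> < 1"
        by (rule spectral_norm_nonneg C2)+
      show "0 \<le> e k" for k by (simp add: e_def norm_star_eq_norm_vec)
      show "d \<longlonglongrightarrow> 0"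
        unfolding d_def using elim by (intro tendsto_null_sum) auto
      show "e (Suc k) \<le> spectral_norm \<Gamma> * e k + d k" for k
      proof -
        \<comment> \<open>Since \<open>xs\<close> is a fixed point, inserting the exact best
          response splits the new error into a contracted old error and the inexactness, whose
          Euclidean norm is at most the sum \<open>d k\<close>.\<close>
        have "(\<chi> i. xk (Suc k) \<omega> i - xs i)
            = (\<chi> i. BR i (xk k \<omega>) - BR i xs) + (\<chi> i. xk (Suc k) \<omega> i - BR i (xk k \<omega>))"
          using xs(2) by (simp add: vec_eq_iff fun_eq_iff)
        then have "e (Suc k) \<le> norm_star (\<lambda>i. BR i (xk k \<omega>) - BR i xs) + norm (\<chi> i. xk (Suc k) \<omega> i - BR i (xk k \<omega>))"
          unfolding e_def norm_star_eq_norm_vec by (simp add: norm_triangle_ineq)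
        moreover have "norm_star (\<lambda>i. BR i (xk k \<omega>) - BR i xs) \<le> spectral_norm \<Gamma> * e k"
          unfolding e_def using range elim xs by (intro bresp_contraction) auto
        moreover have "norm (\<chi> i. xk (Suc k) \<omega> i - BR i (xk k \<omega>)) \<le> d k"
          unfolding d_def Z_def norm_vec_def by (simp add: L2_set_le_sum)
        ultimately show ?thesis by linarith
      qed
    qed
    have "norm (xk k \<omega> i - xs i) \<le> e k" for i k
      using Finite_Cartesian_Product.norm_nth_le[of "\<chi> i. xk k \<omega> i - xs i" i] by (simp add: e_def norm_star_eq_norm_vec)
    then have "eventually (\<lambda>k. norm (xk k \<omega> i - xs i) \<le> e k) sequentially" for i
      by simp
    from Lim_null_comparison[OF this e] have "(\<lambda>k. xk k \<omega> i - xs i) \<longlonglongrightarrow> 0" for i .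
    then show ?case using LIM_zero_iff by blast
  qed
qed

end

theorem theorem4p3:
  fixes S :: "'p::finite \<Rightarrow> 'v::euclidean_space set"
    and X :: "'p \<Rightarrow> 'v set"
    and f :: "'p \<Rightarrow> ('p \<Rightarrow> 'v) \<Rightarrow> real"
    and \<rho> Lh Lm :: "'p \<Rightarrow> real"
    and \<eta> \<mu> :: real
  assumes S: "\<And>i. subspace (S i)"
    and X: "\<And>i. X i \<noteq> {} \<and> closed (X i) \<and> convex (X i) \<and> X i \<subseteq> S i"
    and wc: "\<And>i x. x \<in> profiles S \<Longrightarrow> weakly_convex_on (\<rho> i) (S i) (\<lambda>y. f i (x(i := y)))"
    and rho_pos: "\<And>i. \<rho> i > 0"
    and eta: "\<eta> > 0" "\<And>i. \<eta> < 1 / \<rho> i"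
    and mu: "\<mu> > 0"
    and C1: "\<And>i xi y w. xi \<in> X i \<Longrightarrow> y \<in> profiles X \<Longrightarrow> w \<in> profiles X \<Longrightarrow>
               norm (grad_on (S i) (\<lambda>z. fhat S f \<eta> \<mu> i z y) xi
                     - grad_on (S i) (\<lambda>z. fhat S f \<eta> \<mu> i z w) xi)
               \<le> Lh i * norm (y i - w i) + Lm i * norm_minus i (\<lambda>j. y j - w j)"
    and C2: "spectral_norm (Gamma2 Lh Lm \<mu>) < 1"
  shows
    "(\<forall>y \<in> profiles X. \<forall>w \<in> profiles X. \<forall>i.
        norm (bresp S X f \<eta> \<mu> i y - bresp S X f \<eta> \<mu> i w)
        \<le> (Gamma2 Lh Lm \<mu> *v (\<chi> j. norm (y j - w j))) $ i)
     \<and> (\<forall>y \<in> profiles X. (\<lambda>i. bresp S X f \<eta> \<mu> i y) \<in> profiles X)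
     \<and> (\<exists>q. 0 \<le> q \<and> q < 1 \<and> (\<forall>y \<in> profiles X. \<forall>w \<in> profiles X.
          norm_star (\<lambda>i. bresp S X f \<eta> \<mu> i y - bresp S X f \<eta> \<mu> i w)
          \<le> q * norm_star (\<lambda>i. y i - w i)))
     \<and> (\<exists>xs \<in> profiles X.
          (\<lambda>i. bresp S X f \<eta> \<mu> i xs) = xs
        \<and> (\<forall>x \<in> profiles X. (\<lambda>i. bresp S X f \<eta> \<mu> i x) = x \<longrightarrow> x = xs)
        \<and> (\<forall>x. smoothed_QNE S X f \<eta> x \<longleftrightarrow> x = xs)
        \<and> (\<forall>L :: 'p \<Rightarrow> real.
             (\<forall>i. compact (X i)) \<and>
             (\<forall>i. \<forall>x \<in> profiles S. setval_lipschitz_on (S i) (L i)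
                     (wc_subdiff (\<rho> i) (S i) (\<lambda>y. f i (x(i := y)))))
             \<longrightarrow> eps_QNE X f
                   (\<eta> * (MAX i. L i) * (MAX i. diameter (X i))
                      * (MAX i. norm (pgrad S (fenv S f \<eta> i) i xs))) xs)
        \<and> (\<forall>(M :: 'w measure) (\<epsilon> :: 'p \<Rightarrow> nat \<Rightarrow> real) xk.
             prob_space M \<and> (\<forall>i k. \<epsilon> i k \<ge> 0) \<and> (\<forall>i. summable (\<epsilon> i)) \<and>
             ms_ssbr M S X f \<eta> \<mu> \<epsilon> xk
             \<longrightarrow> (AE \<omega> in M. \<forall>i. (\<lambda>k. xk k \<omega> i) \<longlonglongrightarrow> xs i)))"
proof -
  interpret smoothed_game S X f \<rho> Lh Lm \<eta> \<mu>
    using assms by unfold_locales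
  obtain xs where xs: "xs \<in> profiles X" "\<And>x. x \<in> profiles X \<Longrightarrow> (\<lambda>i. BR i x) = x \<longleftrightarrow> x = xs"
    using bresp_unique_fixed_point by blast
  have fixed: "(\<lambda>i. BR i xs) = xs" using xs by blast
  \<comment> \<open>\<open>smoothed_QNE\<close> includes membership in \<open>profiles X\<close>, so
    the equivalence holds for arbitrary \<open>x\<close>.\<close>
  have qne: "smoothed_QNE S X f \<eta> x \<longleftrightarrow> x = xs" for x
    using xs smoothed_QNE_iff_fixed_point[of x] by blast
  show ?thesis
  proof (intro conjI ballI allI)
    show "\<exists>q. 0 \<le> q \<and> q < 1 \<and> (\<forall>y \<in> profiles X. \<forall>w \<in> profiles X.
          norm_star (\<lambda>i. BR i y - BR i w) \<le> q * norm_star (\<lambda>i. y i - w i))"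
      using spectral_norm_nonneg C2 bresp_contraction by blast
    show "\<exists>xs \<in> profiles X. (\<lambda>i. BR i xs) = xs
        \<and> (\<forall>x \<in> profiles X. (\<lambda>i. BR i x) = x \<longrightarrow> x = xs)
        \<and> (\<forall>x. smoothed_QNE S X f \<eta> x \<longleftrightarrow> x = xs)
        \<and> (\<forall>L :: 'p \<Rightarrow> real.
             (\<forall>i. compact (X i)) \<and>
             (\<forall>i. \<forall>x \<in> profiles S. setval_lipschitz_on (S i) (L i)
                     (wc_subdiff (\<rho> i) (S i) (\<lambda>y. f i (x(i := y)))))
             \<longrightarrow> eps_QNE X f (\<eta> * (MAX i. L i) * (MAX i. diameter (X i)) * (MAX i. norm (G i xs))) xs)
        \<and> (\<forall>(M :: 'w measure) (\<epsilon> :: 'p \<Rightarrow> nat \<Rightarrow> real) xk.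
             prob_space M \<and> (\<forall>i k. \<epsilon> i k \<ge> 0) \<and> (\<forall>i. summable (\<epsilon> i)) \<and>
             ms_ssbr M S X f \<eta> \<mu> \<epsilon> xk
             \<longrightarrow> (AE \<omega> in M. \<forall>i. (\<lambda>k. xk k \<omega> i) \<longlonglongrightarrow> xs i))"
    proof (intro bexI[OF _ xs(1)] conjI allI ballI impI)
      fix L :: "'p \<Rightarrow> real"
      assume "(\<forall>i. compact (X i)) \<and> (\<forall>i. \<forall>x \<in> profiles S. setval_lipschitz_on (S i) (L i)
                     (wc_subdiff (\<rho> i) (S i) (\<lambda>y. f i (x(i := y)))))"
      then show "eps_QNE X f (\<eta> * (MAX i. L i) * (MAX i. diameter (X i)) * (MAX i. norm (G i xs))) xs"
        using qne xs(1) profiles_X_subset_S by (intro smoothed_QNE_imp_eps_QNE) auto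
    next
      fix M :: "'w measure" and \<epsilon> xk
      assume "prob_space M \<and> (\<forall>i k. \<epsilon> i k \<ge> 0) \<and> (\<forall>i. summable (\<epsilon> i)) \<and> ms_ssbr M S X f \<eta> \<mu> \<epsilon> xk"
      then show "AE \<omega> in M. \<forall>i. (\<lambda>k. xk k \<omega> i) \<longlonglongrightarrow> xs i"
        using xs(1) fixed by (intro ms_ssbr_tendsto[of M \<epsilon> xk xs]) auto
    qed (use xs fixed qne in blast)+
  qed (auto simp: bresp_diff_le_Gamma bresp_in_X profiles_def)
qed

end
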